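(* Let $U$ be a $c$-term and $A$ a type. If $\Gamma\vdash_cU:A$, then $\Gamma\vdash_{\lambda_s}\psi(U):A$.
   Context: **Types.** There are two sets of base types $\mathcal{A} = \{a,b,\dots\}$ and $\mathcal{A}^{\perp} = \{a^{\perp},b^{\perp},\dots\}$. The $m$-types are generated by $A ::= a \mid a^{\perp} \mid A\wedge A \mid A\vee A$ ($a\in\mathcal{A}$). A type is either an $m$-type or the constant $\perp$. Negation of $m$-types: $(a)^{\perp}=a^{\perp}$, $(a^{\perp})^{\perp}=a$, $(A\wedge B)^{\perp}=A^{\perp}\vee B^{\perp}$, $(A\vee B)^{\perp}=A^{\perp}\wedge B^{\perp}$. Below $\Gamma$ is a set of declarations assigning $m$-types to variables and, in the rules, $A,B,C$ range over $m$-types. **System $\lambda^{Sym}_{Prop}$.** The $\lambda_s$-terms are the expressions (up to renaming of bound variables) typable by: - $\Gamma, x:A\vdash x:A$; - from $\Gamma\vdash u:A$ and $\Gamma\vdash v:B$ infer $\Gamma\vdash \langle u,v\rangle : A\wedge B$; - from $\Gamma\vdash t:A$ infer $\Gamma\vdash\sigma_1(t):A\vee B$; - from $\Gamma\vdash t:B$ infer $\Gamma\vdash\sigma_2(t):A\vee B$; - from $\Gamma,x:A\vdash t:\perp$ infer $\Gamma\vdash\lambda x.t:A^{\perp}$; - from $\Gamma\vdash u:A^{\perp}$ and $\Gamma\vdash v:A$ infer $\Gamma\vdash u\star v:\perp$. Write $\Gamma\vdash_{\lambda_s}t:A$ for derivability; $Fv$ denotes the set of free variables. **System CCL.** The $c$-terms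 are the expressions built from variables and the constants $\mathbf{K},\mathbf{S},\mathbf{C},\mathbf{P},\mathbf{Q_1},\mathbf{Q_2}$ that are typable by: - $\Gamma,x:A\vdash x:A$; - $\Gamma\vdash\mathbf{K}:A^{\perp}\vee(B\vee A)$; - $\Gamma\vdash\mathbf{S}:(A\wedge(B\wedge C^{\perp}))\vee((A\wedge B^{\perp})\vee(A^{\perp}\vee C))$; - $\Gamma\vdash\mathbf{C}:(A\wedge B)\vee((A\wedge B^{\perp})\vee A^{\perp})$; - $\Gamma\vdash\mathbf{P}:A^{\perp}\vee(B^{\perp}\vee(A\wedge B))$; - $\Gamma\vdash\mathbf{Q_1}:A^{\perp}\vee(A\vee B)$; - $\Gamma\vdash\mathbf{Q_2}:B^{\perp}\vee(A\vee B)$; - from $\Gamma\vdash U:A^{\perp}\vee B$ and $\Gamma\vdash V:A$ infer $\Gamma\vdash(U\;V):B$; - from $\Gamma\vdash U:A^{\perp}$ and $\Gamma\vdash V:A$ infer $\Gamma\vdash U\star V:\perp$. Each axiom holds for all instances of $A,B,C$. Write $\Gamma\vdash_cU:A$ for derivability. **Notation.** For $i\in\{1,2\}$, $\pi_it$ denotes $\lambda x.(t\star\sigma_i(x))$ with $x\notin Fv(t)$; $\pi_{i_1\dots i_n}t$ denotes $\pi_{i_1}\cdots\pi_{i_n}t$ (so $\pi_{12}t=\pi_1(\pi_2t)$). $[u,v]$ denotes $\lambda x.(u\star\langle v,x\rangle)$ with $x\notin Fv(u)\cup Fv(v)$. **Encoding $\psi$ of $c$-terms into $\lambda_s$-terms.**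 - $\psi(x)=x$; - $\psi(\mathbf{K})=\lambda x.(\pi_1x\star\pi_{22}x)$; - $\psi(\mathbf{S})=\lambda x.([[\pi_1x,\pi_{122}x],[\pi_{12}x,\pi_{122}x]]\star\pi_{222}x)$; - $\psi(\mathbf{C})=\lambda x.([\pi_1x,\pi_{22}x]\star[\pi_{12}x,\pi_{22}x])$; - $\psi(\mathbf{P})=\lambda x.(\langle\pi_1x,\pi_{12}x\rangle\star\pi_{22}x)$; - $\psi(\mathbf{Q_1})=\lambda x.(\sigma_1(\pi_1x)\star\pi_2x)$; - $\psi(\mathbf{Q_2})=\lambda x.(\sigma_2(\pi_1x)\star\pi_2x)$; - $\psi((U\;V))=[\psi(U),\psi(V)]$; - $\psi(U\star V)=\psi(U)\star\psi(V)$. *)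

theory Defs
  imports Main
begin

datatype 'a mtype =
    Atom 'a
  | NAtom 'a
  | And "'a mtype" "'a mtype" (infixr "\<^bold>\<and>" 70)
  | Or "'a mtype" "'a mtype" (infixr "\<^bold>\<or>" 65)

datatype 'a ty = MType "'a mtype" | Bot

text \<open>Negation is not a type constructor but an operation on m-types, involutive by De Morgan.\<close>

primrec neg :: "'a mtype \<Rightarrow> 'a mtype" ("_\<^sup>\<bottom>" [1000] 1000) where
  "(Atom a)\<^sup>\<bottom> = NAtom a"
| "(NAtom a)\<^sup>\<bottom> = Atom a"
| "(A \<^bold>\<and> B)\<^sup>\<bottom> = A\<^sup>\<bottom> \<^bold>\<or> B\<^sup>\<bottom>"
| "(A \<^bold>\<or> B)\<^sup>\<bottom> = A\<^sup>\<bottom> \<^bold>\<and> B\<^sup>\<bottom>"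

text \<open>
  Variables are natural numbers. Expressions of the symmetric lambda calculus are taken up to
  renaming of bound variables, so they are represented with de Bruijn indices: under \<open>n\<close> binders,
  the free variable \<open>x\<close> is written \<open>Var (x + n)\<close>. A set of declarations is a
  partial function from variables to m-types (not necessarily finite).
\<close>

type_synonym 'a ctxt = "nat \<Rightarrow> 'a mtype option"

datatype lexp =
    Var nat
  | Pair lexp lexp
  | Inj1 lexp ("\<sigma>\<^sub>1")
  | Inj2 lexp ("\<sigma>\<^sub>2")
  | Lam lexp
  | Star lexp lexp (infix "\<star>" 60)

text \<open>The context of the body of a binder: index 0 is the bound variable, the others are shifted.\<close>

definition extend :: "'a ctxt \<Rightarrow> 'a mtype \<Rightarrow> 'a ctxt" where
  "extend \<Gamma> A = (\<lambda>n. case n of 0 \<Rightarrow> Some A | Suc m \<Rightarrow> \<Gamma> m)"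

inductive lam_typing :: "'a ctxt \<Rightarrow> lexp \<Rightarrow> 'a ty \<Rightarrow> bool" ("_ \<turnstile>\<^sub>\<lambda> _ : _" [50, 50, 50] 50) where
  lam_var: "\<Gamma> x = Some A \<Longrightarrow> \<Gamma> \<turnstile>\<^sub>\<lambda> Var x : MType A"
| lam_pair: "\<Gamma> \<turnstile>\<^sub>\<lambda> u : MType A \<Longrightarrow> \<Gamma> \<turnstile>\<^sub>\<lambda> v : MType B \<Longrightarrow> \<Gamma> \<turnstile>\<^sub>\<lambda> Pair u v : MType (A \<^bold>\<and> B)"
| lam_inj1: "\<Gamma> \<turnstile>\<^sub>\<lambda> t : MType A \<Longrightarrow> \<Gamma> \<turnstile>\<^sub>\<lambda> \<sigma>\<^sub>1 t : MType (A \<^bold>\<or> B)"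
| lam_inj2: "\<Gamma> \<turnstile>\<^sub>\<lambda> t : MType B \<Longrightarrow> \<Gamma> \<turnstile>\<^sub>\<lambda> \<sigma>\<^sub>2 t : MType (A \<^bold>\<or> B)"
| lam_abs: "extend \<Gamma> A \<turnstile>\<^sub>\<lambda> t : Bot \<Longrightarrow> \<Gamma> \<turnstile>\<^sub>\<lambda> Lam t : MType (A\<^sup>\<bottom>)"
| lam_star: "\<Gamma> \<turnstile>\<^sub>\<lambda> u : MType (A\<^sup>\<bottom>) \<Longrightarrow> \<Gamma> \<turnstile>\<^sub>\<lambda> v : MType A \<Longrightarrow> \<Gamma> \<turnstile>\<^sub>\<lambda> u \<star> v : Bot"

text \<open>
  The c-terms are the expressions that are typable in some context; every expression occurring in
  a derivable judgement is therefore a c-term. The same holds for the symmetric lambda calculus.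
\<close>

datatype cexp =
    CVar nat
  | K\<^sub>c | S\<^sub>c | C\<^sub>c | P\<^sub>c | Q1\<^sub>c | Q2\<^sub>c
  | App cexp cexp
  | CStar cexp cexp (infix "\<star>\<^sub>c" 60)

inductive c_typing :: "'a ctxt \<Rightarrow> cexp \<Rightarrow> 'a ty \<Rightarrow> bool" ("_ \<turnstile>\<^sub>c _ : _" [50, 50, 50] 50) where
  c_var: "\<Gamma> x = Some A \<Longrightarrow> \<Gamma> \<turnstile>\<^sub>c CVar x : MType A"
| c_K: "\<Gamma> \<turnstile>\<^sub>c K\<^sub>c : MType (A\<^sup>\<bottom> \<^bold>\<or> (B \<^bold>\<or> A))"
| c_S: "\<Gamma> \<turnstile>\<^sub>c S\<^sub>c : MType ((A \<^bold>\<and> (B \<^bold>\<and> C\<^sup>\<bottom>)) \<^bold>\<or> ((A \<^bold>\<and> B\<^sup>\<bottom>) \<^bold>\<or> (A\<^sup>\<bottom> \<^bold>\<or> C)))"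
| c_C: "\<Gamma> \<turnstile>\<^sub>c C\<^sub>c : MType ((A \<^bold>\<and> B) \<^bold>\<or> ((A \<^bold>\<and> B\<^sup>\<bottom>) \<^bold>\<or> A\<^sup>\<bottom>))"
| c_P: "\<Gamma> \<turnstile>\<^sub>c P\<^sub>c : MType (A\<^sup>\<bottom> \<^bold>\<or> (B\<^sup>\<bottom> \<^bold>\<or> (A \<^bold>\<and> B)))"
| c_Q1: "\<Gamma> \<turnstile>\<^sub>c Q1\<^sub>c : MType (A\<^sup>\<bottom> \<^bold>\<or> (A \<^bold>\<or> B))"
| c_Q2: "\<Gamma> \<turnstile>\<^sub>c Q2\<^sub>c : MType (B\<^sup>\<bottom> \<^bold>\<or> (A \<^bold>\<or> B))"
| c_app: "\<Gamma> \<turnstile>\<^sub>c U : MType (A\<^sup>\<bottom> \<^bold>\<or> B) \<Longrightarrow> \<Gamma> \<turnstile>\<^sub>c V : MType A \<Longrightarrow> \<Gamma> \<turnstile>\<^sub>c App U V : MType B"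
| c_star: "\<Gamma> \<turnstile>\<^sub>c U : MType (A\<^sup>\<bottom>) \<Longrightarrow> \<Gamma> \<turnstile>\<^sub>c V : MType A \<Longrightarrow> \<Gamma> \<turnstile>\<^sub>c U \<star>\<^sub>c V : Bot"

text \<open>
  \<open>lift k t\<close> shifts by one every index of \<open>t\<close> that is at least \<open>k\<close>. Placing \<open>lift 0 t\<close> under a
  new binder is the de Bruijn form of the side condition that the bound variable is not free in \<open>t\<close>.
\<close>

primrec lift :: "nat \<Rightarrow> lexp \<Rightarrow> lexp" where
  "lift k (Var i) = Var (if i < k then i else Suc i)"
| "lift k (Pair u v) = Pair (lift k u) (lift k v)"
| "lift k (\<sigma>\<^sub>1 t) = \<sigma>\<^sub>1 (lift k t)"
| "lift k (\<sigma>\<^sub>2 t) = \<sigma>\<^sub>2 (lift k t)"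
| "lift k (Lam t) = Lam (lift (Suc k) t)"
| "lift k (u \<star> v) = lift k u \<star> lift k v"

definition proj1 :: "lexp \<Rightarrow> lexp" ("\<pi>\<^sub>1") where
  "\<pi>\<^sub>1 t = Lam (lift 0 t \<star> \<sigma>\<^sub>1 (Var 0))"

definition proj2 :: "lexp \<Rightarrow> lexp" ("\<pi>\<^sub>2") where
  "\<pi>\<^sub>2 t = Lam (lift 0 t \<star> \<sigma>\<^sub>2 (Var 0))"

text \<open>\<open>bracket u v\<close> is the term written $[u,v]$, that is, $\lambda x.(u \star \langle v,x\rangle)$ with $x$ fresh.\<close>

definition bracket :: "lexp \<Rightarrow> lexp \<Rightarrow> lexp" where
  "bracket u v = Lam (lift 0 u \<star> Pair (lift 0 v) (Var 0))"

primrec \<psi> :: "cexp \<Rightarrow> lexp" where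
  "\<psi> (CVar x) = Var x"
| "\<psi> K\<^sub>c = Lam (\<pi>\<^sub>1 (Var 0) \<star> \<pi>\<^sub>2 (\<pi>\<^sub>2 (Var 0)))"
| "\<psi> S\<^sub>c = Lam (bracket (bracket (\<pi>\<^sub>1 (Var 0)) (\<pi>\<^sub>1 (\<pi>\<^sub>2 (\<pi>\<^sub>2 (Var 0)))))
                       (bracket (\<pi>\<^sub>1 (\<pi>\<^sub>2 (Var 0))) (\<pi>\<^sub>1 (\<pi>\<^sub>2 (\<pi>\<^sub>2 (Var 0)))))
              \<star> \<pi>\<^sub>2 (\<pi>\<^sub>2 (\<pi>\<^sub>2 (Var 0))))"
| "\<psi> C\<^sub>c = Lam (bracket (\<pi>\<^sub>1 (Var 0)) (\<pi>\<^sub>2 (\<pi>\<^sub>2 (Var 0)))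
              \<star> bracket (\<pi>\<^sub>1 (\<pi>\<^sub>2 (Var 0))) (\<pi>\<^sub>2 (\<pi>\<^sub>2 (Var 0))))"
| "\<psi> P\<^sub>c = Lam (Pair (\<pi>\<^sub>1 (Var 0)) (\<pi>\<^sub>1 (\<pi>\<^sub>2 (Var 0))) \<star> \<pi>\<^sub>2 (\<pi>\<^sub>2 (Var 0)))"
| "\<psi> Q1\<^sub>c = Lam (\<sigma>\<^sub>1 (\<pi>\<^sub>1 (Var 0)) \<star> \<pi>\<^sub>2 (Var 0))"
| "\<psi> Q2\<^sub>c = Lam (\<sigma>\<^sub>2 (\<pi>\<^sub>1 (Var 0)) \<star> \<pi>\<^sub>2 (Var 0))"
| "\<psi> (App U V) = bracket (\<psi> U) (\<psi> V)"
| "\<psi> (U \<star>\<^sub>c V) = \<psi> U \<star> \<psi> V"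

end

theory Submission
  imports Defs
begin

text \<open>
  The encoding preserves types because negation is involutive: an inhabitant of \<open>B\<close> is obtained by
  binding a variable of type \<open>B\<^sup>\<bottom>\<close> and deriving a contradiction. Application is sound for this
  reason: \<open>A\<^sup>\<bottom> \<^bold>\<or> B\<close> is the negation of \<open>A \<^bold>\<and> B\<^sup>\<bottom>\<close>, so a function is refuted by a pair of an argument
  and a refutation of the result (lemma \<open>lam_bracket\<close>). Projections are the same phenomenon with an
  injection as the refuting term (lemmas \<open>lam_proj1\<close> and \<open>lam_proj2\<close>).

  Each combinator of type \<open>T\<close> is encoded by an abstraction over a variable of type \<open>T\<^sup>\<bottom>\<close>. By De
  Morgan, \<open>T\<^sup>\<bottom>\<close> is a right-nested conjunction of the arguments of the combinator and of the negation
  of its result. The projections extract these components, and the body confronts two terms of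
  opposite types. With the three derived rules, the theorem follows by induction on the typing
  derivation. The derived rules place terms under a fresh binder, which requires
  weakening (lemma \<open>lam_lift\<close>).
\<close>

lemma neg_neg [simp]: "(A\<^sup>\<bottom>)\<^sup>\<bottom> = A"
  by (induction A) simp_all

text \<open>
  The hypothesis compares the contexts only through the renaming that \<open>lift k\<close> performs; this form
  is stable under passing below a binder, where \<open>k\<close> becomes \<open>Suc k\<close>.
\<close>

lemma lam_lift:
  assumes "\<Gamma> \<turnstile>\<^sub>\<lambda> t : T"
    and "\<And>i A. \<Gamma> i = Some A \<Longrightarrow> \<Delta> (if i < k then i else Suc i) = Some A"
  shows "\<Delta> \<turnstile>\<^sub>\<lambda> lift k t : T"
  using assms
proof (induction arbitrary: \<Delta> k rule: lam_typing.induct)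
  case (lam_var \<Gamma> x A)
  then show ?case
    by (simp only: lift.simps lam_typing.lam_var)
next
  case (lam_abs \<Gamma> A t)
  have "extend \<Delta> A (if i < Suc k then i else Suc i) = Some B"
    if "extend \<Gamma> A i = Some B" for i B
    using that lam_abs.prems[of "i - 1"] by (cases i) (auto simp: extend_def split: if_splits)
  then show ?case
    by (simp add: lam_abs.IH lam_typing.lam_abs)
next
  case lam_star
  then show ?case
    by (metis lift.simps(6) lam_typing.lam_star)
qed (simp_all add: lam_typing.intros)

lemma lam_weaken: "\<Gamma> \<turnstile>\<^sub>\<lambda> t : T \<Longrightarrow> extend \<Gamma> B \<turnstile>\<^sub>\<lambda> lift 0 t : T"
  by (erule lam_lift) (simp add: extend_def)

lemma lam_var0: "extend \<Gamma> A \<turnstile>\<^sub>\<lambda> Var 0 : MType A"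
  by (simp add: lam_var extend_def)

text \<open>
  The abstraction rule read backwards. The rule \<open>lam_abs\<close> types abstractions only at types of the
  form \<open>A\<^sup>\<bottom>\<close>; by involution this is every m-type.
\<close>

lemma lam_by_contradiction: "extend \<Gamma> (A\<^sup>\<bottom>) \<turnstile>\<^sub>\<lambda> t : Bot \<Longrightarrow> \<Gamma> \<turnstile>\<^sub>\<lambda> Lam t : MType A"
  using lam_abs[of \<Gamma> "A\<^sup>\<bottom>"] by simp

lemma lam_star_neg:
  "\<Gamma> \<turnstile>\<^sub>\<lambda> u : MType A \<Longrightarrow> \<Gamma> \<turnstile>\<^sub>\<lambda> v : MType (A\<^sup>\<bottom>) \<Longrightarrow> \<Gamma> \<turnstile>\<^sub>\<lambda> u \<star> v : Bot"
  using lam_star[of \<Gamma> u "A\<^sup>\<bottom>"] by simp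

text \<open>A refutation of \<open>A\<close> injects into a refutation of \<open>A \<^bold>\<and> B\<close>, which contradicts \<open>t\<close>.\<close>

lemma lam_proj1:
  assumes "\<Gamma> \<turnstile>\<^sub>\<lambda> t : MType (A \<^bold>\<and> B)"
  shows "\<Gamma> \<turnstile>\<^sub>\<lambda> \<pi>\<^sub>1 t : MType A"
  unfolding proj1_def
  by (rule lam_by_contradiction, rule lam_star_neg, rule lam_weaken[OF assms])
     (simp add: lam_inj1 lam_var0)

lemma lam_proj2:
  assumes "\<Gamma> \<turnstile>\<^sub>\<lambda> t : MType (A \<^bold>\<and> B)"
  shows "\<Gamma> \<turnstile>\<^sub>\<lambda> \<pi>\<^sub>2 t : MType B"
  unfolding proj2_def
  by (rule lam_by_contradiction, rule lam_star_neg, rule lam_weaken[OF assms])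
     (simp add: lam_inj2 lam_var0)

text \<open>
  Modus ponens: a refutation of \<open>B\<close>, paired with the argument \<open>v\<close>, refutes the type of \<open>u\<close>.
\<close>

lemma lam_bracket:
  assumes "\<Gamma> \<turnstile>\<^sub>\<lambda> u : MType (A\<^sup>\<bottom> \<^bold>\<or> B)" and "\<Gamma> \<turnstile>\<^sub>\<lambda> v : MType A"
  shows "\<Gamma> \<turnstile>\<^sub>\<lambda> bracket u v : MType B"
  unfolding bracket_def
  by (rule lam_by_contradiction, rule lam_star_neg, rule lam_weaken[OF assms(1)])
     (simp add: lam_pair lam_var0 lam_weaken[OF assms(2)])

theorem theorem27:
  fixes \<Gamma> :: "'a ctxt" and U :: cexp and A :: "'a ty"
  assumes "\<Gamma> \<turnstile>\<^sub>c U : A"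
  shows "\<Gamma> \<turnstile>\<^sub>\<lambda> \<psi> U : A"
  using assms
proof (induction rule: c_typing.induct)
  case (c_var \<Gamma> x A)
  then show ?case
    by (simp add: lam_var)
next
  case (c_K \<Gamma> A B)
  \<comment> \<open>Here and in the other combinator cases, \<open>?T\<close> is the negation of the goal type, De Morgan
    applied: the type of the bound variable.\<close>
  let ?T = "A \<^bold>\<and> (B\<^sup>\<bottom> \<^bold>\<and> A\<^sup>\<bottom>)"
  have x: "extend \<Gamma> ?T \<turnstile>\<^sub>\<lambda> Var 0 : MType ?T"
    by (rule lam_var0)
  have "extend \<Gamma> ?T \<turnstile>\<^sub>\<lambda> \<pi>\<^sub>1 (Var 0) \<star> \<pi>\<^sub>2 (\<pi>\<^sub>2 (Var 0)) : Bot"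
    by (rule lam_star_neg) (rule lam_proj1 lam_proj2 x)+
  then show ?case
    by (simp add: lam_by_contradiction)
next
  case (c_S \<Gamma> A B C)
  let ?T = "(A\<^sup>\<bottom> \<^bold>\<or> (B\<^sup>\<bottom> \<^bold>\<or> C)) \<^bold>\<and> ((A\<^sup>\<bottom> \<^bold>\<or> B) \<^bold>\<and> (A \<^bold>\<and> C\<^sup>\<bottom>))"
  let ?f = "\<pi>\<^sub>1 (Var 0)" and ?g = "\<pi>\<^sub>1 (\<pi>\<^sub>2 (Var 0))" and ?a = "\<pi>\<^sub>1 (\<pi>\<^sub>2 (\<pi>\<^sub>2 (Var 0)))"
  have x: "extend \<Gamma> ?T \<turnstile>\<^sub>\<lambda> Var 0 : MType ?T"
    by (rule lam_var0)
  have f: "extend \<Gamma> ?T \<turnstile>\<^sub>\<lambda> ?f : MType (A\<^sup>\<bottom> \<^bold>\<or> (B\<^sup>\<bottom> \<^bold>\<or> C))"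
    and g: "extend \<Gamma> ?T \<turnstile>\<^sub>\<lambda> ?g : MType (A\<^sup>\<bottom> \<^bold>\<or> B)"
    and a: "extend \<Gamma> ?T \<turnstile>\<^sub>\<lambda> ?a : MType A"
    and c: "extend \<Gamma> ?T \<turnstile>\<^sub>\<lambda> \<pi>\<^sub>2 (\<pi>\<^sub>2 (\<pi>\<^sub>2 (Var 0))) : MType (C\<^sup>\<bottom>)"
    by (rule lam_proj1 lam_proj2 x)+
  have "extend \<Gamma> ?T \<turnstile>\<^sub>\<lambda> bracket (bracket ?f ?a) (bracket ?g ?a) : MType C"
    by (rule lam_bracket[OF lam_bracket[OF f a] lam_bracket[OF g a]])
  from lam_star_neg[OF this c] show ?case
    by (simp add: lam_by_contradiction)
next
  case (c_C \<Gamma> A B)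
  let ?T = "(A\<^sup>\<bottom> \<^bold>\<or> B\<^sup>\<bottom>) \<^bold>\<and> ((A\<^sup>\<bottom> \<^bold>\<or> B) \<^bold>\<and> A)"
  have x: "extend \<Gamma> ?T \<turnstile>\<^sub>\<lambda> Var 0 : MType ?T"
    by (rule lam_var0)
  have f: "extend \<Gamma> ?T \<turnstile>\<^sub>\<lambda> \<pi>\<^sub>1 (Var 0) : MType (A\<^sup>\<bottom> \<^bold>\<or> B\<^sup>\<bottom>)"
    and g: "extend \<Gamma> ?T \<turnstile>\<^sub>\<lambda> \<pi>\<^sub>1 (\<pi>\<^sub>2 (Var 0)) : MType (A\<^sup>\<bottom> \<^bold>\<or> B)"
    and a: "extend \<Gamma> ?T \<turnstile>\<^sub>\<lambda> \<pi>\<^sub>2 (\<pi>\<^sub>2 (Var 0)) : MType A"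
    by (rule lam_proj1 lam_proj2 x)+
  from lam_star[OF lam_bracket[OF f a] lam_bracket[OF g a]] show ?case
    by (simp add: lam_by_contradiction)
next
  case (c_P \<Gamma> A B)
  let ?T = "A \<^bold>\<and> (B \<^bold>\<and> (A\<^sup>\<bottom> \<^bold>\<or> B\<^sup>\<bottom>))"
  have x: "extend \<Gamma> ?T \<turnstile>\<^sub>\<lambda> Var 0 : MType ?T"
    by (rule lam_var0)
  have p: "extend \<Gamma> ?T \<turnstile>\<^sub>\<lambda> Pair (\<pi>\<^sub>1 (Var 0)) (\<pi>\<^sub>1 (\<pi>\<^sub>2 (Var 0))) : MType (A \<^bold>\<and> B)"
    and n: "extend \<Gamma> ?T \<turnstile>\<^sub>\<lambda> \<pi>\<^sub>2 (\<pi>\<^sub>2 (Var 0)) : MType (A\<^sup>\<bottom> \<^bold>\<or> B\<^sup>\<bottom>)"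
    by (rule lam_pair lam_proj1 lam_proj2 x)+
  have "extend \<Gamma> ?T \<turnstile>\<^sub>\<lambda> Pair (\<pi>\<^sub>1 (Var 0)) (\<pi>\<^sub>1 (\<pi>\<^sub>2 (Var 0))) \<star> \<pi>\<^sub>2 (\<pi>\<^sub>2 (Var 0)) : Bot"
    using lam_star_neg[OF p] n by simp
  then show ?case
    by (simp add: lam_by_contradiction)
next
  case (c_Q1 \<Gamma> A B)
  let ?T = "A \<^bold>\<and> (A\<^sup>\<bottom> \<^bold>\<and> B\<^sup>\<bottom>)"
  have x: "extend \<Gamma> ?T \<turnstile>\<^sub>\<lambda> Var 0 : MType ?T"
    by (rule lam_var0)
  have "extend \<Gamma> ?T \<turnstile>\<^sub>\<lambda> \<sigma>\<^sub>1 (\<pi>\<^sub>1 (Var 0)) \<star> \<pi>\<^sub>2 (Var 0) : Bot"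
    using lam_star_neg[OF lam_inj1[OF lam_proj1[OF x], of B]] lam_proj2[OF x] by simp
  then show ?case
    by (simp add: lam_by_contradiction)
next
  case (c_Q2 \<Gamma> B A)
  let ?T = "B \<^bold>\<and> (A\<^sup>\<bottom> \<^bold>\<and> B\<^sup>\<bottom>)"
  have x: "extend \<Gamma> ?T \<turnstile>\<^sub>\<lambda> Var 0 : MType ?T"
    by (rule lam_var0)
  have "extend \<Gamma> ?T \<turnstile>\<^sub>\<lambda> \<sigma>\<^sub>2 (\<pi>\<^sub>1 (Var 0)) \<star> \<pi>\<^sub>2 (Var 0) : Bot"
    using lam_star_neg[OF lam_inj2[OF lam_proj1[OF x], of A]] lam_proj2[OF x] by simp
  then show ?case
    by (simp add: lam_by_contradiction)
next
  case (c_app \<Gamma> U A B V)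
  then show ?case
    using lam_bracket by simp
next
  case (c_star \<Gamma> U A V)
  then show ?case
    using lam_star by simp
qed

end
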